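(* The Hilbert space $L^2[0,1]$ has the direct sum decomposition $$L^2[0,1]=\mathbb{P}\oplus\mathbb{A}.$$
   Context: $L^2[0,1]$ is the space of square integrable complex-valued functions on $[0,1]$ (modulo a.e. equality). The reflection-even and reflection-odd subspaces are $\mathbb{P}=\{f\in L^2[0,1]: f(x)=f(1-x)\text{ for a.e. }x\in[0,1]\}$ and $\mathbb{A}=\{f\in L^2[0,1]: f(x)=-f(1-x)\text{ for a.e. }x\in[0,1]\}$. *)

theory Defs
  imports "HOL-Analysis.Analysis"
begin

section \<open>The complex Hilbert space \<open>L\<^sup>2[0,1]\<close>\<close>

abbreviation M01 :: "real measure"
  where "M01 \<equiv> lebesgue_on {0..1}"

definition square_integrable :: "(real \<Rightarrow> complex) \<Rightarrow> bool"
  where "square_integrable f \<longleftrightarrow>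
    f \<in> borel_measurable M01 \<and> integrable M01 (\<lambda>x. (cmod (f x))\<^sup>2)"

definition L2_rel :: "(real \<Rightarrow> complex) \<Rightarrow> (real \<Rightarrow> complex) \<Rightarrow> bool"
  where "L2_rel f g \<longleftrightarrow>
    square_integrable f \<and> square_integrable g \<and> (AE x in M01. f x = g x)"

lemma square_integrable_zero: "square_integrable (\<lambda>x. 0)"
  by (simp add: square_integrable_def)

lemma cmod_add_power2_le: "(cmod (a + b))\<^sup>2 \<le> 2 * (cmod a)\<^sup>2 + 2 * (cmod b)\<^sup>2"
proof -
  have "(cmod (a + b))\<^sup>2 \<le> (cmod a + cmod b)\<^sup>2"
    by (intro power_mono norm_triangle_ineq) auto
  also have "\<dots> \<le> 2 * (cmod a)\<^sup>2 + 2 * (cmod b)\<^sup>2"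
    using sum_squares_bound[of "cmod a" "cmod b"] by (simp add: power2_sum)
  finally show ?thesis .
qed

lemma square_integrable_add:
  assumes "square_integrable f" "square_integrable g"
  shows "square_integrable (\<lambda>x. f x + g x)"
proof -
  have [measurable]: "f \<in> borel_measurable M01" "g \<in> borel_measurable M01"
    using assms by (auto simp: square_integrable_def)
  have "integrable M01 (\<lambda>x. 2 * (cmod (f x))\<^sup>2 + 2 * (cmod (g x))\<^sup>2)"
    using assms by (auto simp: square_integrable_def)
  then have "integrable M01 (\<lambda>x. (cmod (f x + g x))\<^sup>2)"
    by (rule Bochner_Integration.integrable_bound) (use cmod_add_power2_le in auto)
  then show ?thesis
    by (simp add: square_integrable_def)
qed

lemma square_integrable_scale:
  assumes "square_integrable f"
  shows "square_integrable (\<lambda>x. c * f x)"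
  using assms by (auto simp: square_integrable_def norm_mult power_mult_distrib)

lemma square_integrable_minus:
  assumes "square_integrable f"
  shows "square_integrable (\<lambda>x. - f x)"
  using assms by (auto simp: square_integrable_def)

lemma square_integrable_diff:
  assumes "square_integrable f" "square_integrable g"
  shows "square_integrable (\<lambda>x. f x - g x)"
  using square_integrable_add[OF assms(1) square_integrable_minus[OF assms(2)]] by simp

lemma measurable_inner_product:
  assumes "square_integrable f" "square_integrable g"
  shows "(\<lambda>x. f x * cnj (g x)) \<in> borel_measurable M01"
proof -
  have [measurable]: "f \<in> borel_measurable M01" "g \<in> borel_measurable M01"
    using assms by (auto simp: square_integrable_def)
  have [measurable]: "cnj \<in> borel_measurable borel"
    by (intro borel_measurable_continuous_onI continuous_intros)
  show ?thesis
    by measurable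
qed

lemma integrable_inner_product:
  assumes "square_integrable f" "square_integrable g"
  shows "integrable M01 (\<lambda>x. f x * cnj (g x))"
proof -
  have "integrable M01 (\<lambda>x. (cmod (f x))\<^sup>2 + (cmod (g x))\<^sup>2)"
    using assms by (auto simp: square_integrable_def)
  moreover have "cmod (a * cnj b) \<le> norm ((cmod a)\<^sup>2 + (cmod b)\<^sup>2)" for a b
  proof -
    have "2 * (cmod a * cmod b) \<le> (cmod a)\<^sup>2 + (cmod b)\<^sup>2"
      using sum_squares_bound[of "cmod a" "cmod b"] by (simp add: mult.assoc)
    moreover have "0 \<le> cmod a * cmod b"
      by (intro mult_nonneg_nonneg) auto
    ultimately have "cmod a * cmod b \<le> (cmod a)\<^sup>2 + (cmod b)\<^sup>2"
      by linarith
    then show ?thesis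
      by (simp add: norm_mult)
  qed
  ultimately show ?thesis
    by (rule_tac Bochner_Integration.integrable_bound)
      (auto intro: measurable_inner_product assms)
qed

quotient_type L2 = "real \<Rightarrow> complex" / partial: L2_rel
proof (rule part_equivpI)
  show "\<exists>f. L2_rel f f"
    using square_integrable_zero by (auto simp: L2_rel_def)
  show "symp L2_rel"
    by (auto simp: symp_def L2_rel_def elim: eventually_mono)
  show "transp L2_rel"
    unfolding transp_def L2_rel_def by (auto elim: eventually_elim2)
qed

instantiation L2 :: ab_group_add
begin

lift_definition zero_L2 :: L2 is "\<lambda>x. 0"
  by (simp add: L2_rel_def square_integrable_zero)

lift_definition plus_L2 :: "L2 \<Rightarrow> L2 \<Rightarrow> L2" is "\<lambda>f g x. f x + g x"
  unfolding L2_rel_def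
  by (auto intro!: square_integrable_add elim: eventually_elim2)

lift_definition uminus_L2 :: "L2 \<Rightarrow> L2" is "\<lambda>f x. - f x"
  unfolding L2_rel_def
  by (auto intro!: square_integrable_minus elim: eventually_mono)

lift_definition minus_L2 :: "L2 \<Rightarrow> L2 \<Rightarrow> L2" is "\<lambda>f g x. f x - g x"
  unfolding L2_rel_def
  by (auto intro!: square_integrable_diff elim: eventually_elim2)

instance
proof
  fix a b c :: L2
  show "a + b + c = a + (b + c)"
    by transfer (auto simp: L2_rel_def algebra_simps intro!: square_integrable_add)
  show "a + b = b + a"
    by transfer (auto simp: L2_rel_def add.commute intro!: square_integrable_add)
  show "0 + a = a"
    by transfer (auto simp: L2_rel_def)
  show "- a + a = 0"
    by transfer (auto simp: L2_rel_def square_integrable_zero)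
  show "a - b = a + - b"
    by transfer (auto simp: L2_rel_def intro!: square_integrable_diff)
qed

end

lift_definition scaleC_L2 :: "complex \<Rightarrow> L2 \<Rightarrow> L2" (infixr "*\<^sub>C" 75) is "\<lambda>c f x. c * f x"
  unfolding L2_rel_def
  by (auto intro!: square_integrable_scale elim: eventually_mono)

global_interpretation L2: vector_space scaleC_L2
proof
  fix a b :: complex and x y :: L2
  show "a *\<^sub>C (x + y) = a *\<^sub>C x + a *\<^sub>C y"
    by transfer (auto simp: L2_rel_def algebra_simps
        intro!: square_integrable_add square_integrable_scale)
  show "(a + b) *\<^sub>C x = a *\<^sub>C x + b *\<^sub>C x"
    by transfer (auto simp: L2_rel_def algebra_simps
        intro!: square_integrable_add square_integrable_scale)
  show "a *\<^sub>C b *\<^sub>C x = (a * b) *\<^sub>C x"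
    by transfer (auto simp: L2_rel_def mult.assoc
        intro!: square_integrable_scale[of _ "_ * _", unfolded mult.assoc])
  show "1 *\<^sub>C x = x"
    by transfer (auto simp: L2_rel_def)
qed

text \<open>The inner product is linear in its first and antilinear in its second argument.\<close>

lift_definition cinner_L2 :: "L2 \<Rightarrow> L2 \<Rightarrow> complex"
  is "\<lambda>f g. \<integral>x. f x * cnj (g x) \<partial>M01"
  unfolding L2_rel_def
  by (intro integral_cong_AE) (auto intro: measurable_inner_product elim: eventually_elim2)

lemma cinner_L2_add_left: "cinner_L2 (f + g) h = cinner_L2 f h + cinner_L2 g h"
  by transfer (auto simp: L2_rel_def algebra_simps integrable_inner_product)

lemma cinner_L2_scaleC_left: "cinner_L2 (c *\<^sub>C f) h = c * cinner_L2 f h"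
  by transfer (auto simp: L2_rel_def mult.assoc)

lemma cinner_L2_commute: "cinner_L2 f g = cnj (cinner_L2 g f)"
  by transfer (simp flip: Bochner_Integration.integral_cnj add: mult.commute)

lemma cinner_L2_self:
  "square_integrable f \<Longrightarrow> (\<integral>x. f x * cnj (f x) \<partial>M01) = of_real (\<integral>x. (cmod (f x))\<^sup>2 \<partial>M01)"
  by (simp add: complex_norm_square[symmetric] del: of_real_power)

lemma cinner_L2_self_ge_0: "0 \<le> Re (cinner_L2 f f)"
  by transfer (simp add: cinner_L2_self L2_rel_def)

lemma cinner_L2_self_eq_0: "Re (cinner_L2 f f) = 0 \<longleftrightarrow> f = 0"
proof (transfer, goal_cases)
  case (1 f)
  then have f: "square_integrable f"
    by (simp add: L2_rel_def)
  have "(\<integral>x. (cmod (f x))\<^sup>2 \<partial>M01) = 0 \<longleftrightarrow> (AE x in M01. (cmod (f x))\<^sup>2 = 0)"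
    by (rule integral_nonneg_eq_0_iff_AE) (use f in \<open>auto simp: square_integrable_def\<close>)
  with f show ?case
    by (simp add: cinner_L2_self L2_rel_def square_integrable_zero)
qed

instantiation L2 :: real_vector
begin

definition scaleR_L2 :: "real \<Rightarrow> L2 \<Rightarrow> L2"
  where "scaleR_L2 r f = complex_of_real r *\<^sub>C f"

instance
  by standard (simp_all add: scaleR_L2_def L2.scale_right_distrib L2.scale_left_distrib)

end

text \<open>
  The norm and the topology come from the complex inner product, whose real part is the
  inner product required by the type class.
\<close>

instantiation L2 :: real_inner
begin

definition inner_L2 :: "L2 \<Rightarrow> L2 \<Rightarrow> real"
  where "inner_L2 f g = Re (cinner_L2 f g)"

definition norm_L2 :: "L2 \<Rightarrow> real"
  where "norm_L2 f = sqrt (Re (cinner_L2 f f))"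

definition sgn_L2 :: "L2 \<Rightarrow> L2"
  where "sgn_L2 f = f /\<^sub>R norm f"

definition dist_L2 :: "L2 \<Rightarrow> L2 \<Rightarrow> real"
  where "dist_L2 f g = norm (f - g)"

definition uniformity_L2 :: "(L2 \<times> L2) filter"
  where "uniformity_L2 = (INF e\<in>{0<..}. principal {(f, g). dist f g < e})"

definition open_L2 :: "L2 set \<Rightarrow> bool"
  where "open_L2 U \<longleftrightarrow> (\<forall>f\<in>U. \<forall>\<^sub>F (f', g) in uniformity. f' = f \<longrightarrow> g \<in> U)"

instance
proof
  fix a :: real and f g h :: L2 and U :: "L2 set"
  show "sgn f = f /\<^sub>R norm f" "dist f g = norm (f - g)"
    by (simp_all add: sgn_L2_def dist_L2_def)
  show "uniformity = (INF e\<in>{0<..}. principal {(x :: L2, y). dist x y < e})"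
    by (simp add: uniformity_L2_def)
  show "open U \<longleftrightarrow> (\<forall>f\<in>U. \<forall>\<^sub>F (f', g) in uniformity. f' = f \<longrightarrow> g \<in> U)"
    by (simp add: open_L2_def)
  show "inner f g = inner g f"
    by (simp add: inner_L2_def cinner_L2_commute[of f g])
  show "inner (f + g) h = inner f h + inner g h" "inner (a *\<^sub>R f) g = a * inner f g"
    by (simp_all add: inner_L2_def scaleR_L2_def cinner_L2_add_left cinner_L2_scaleC_left)
  show "0 \<le> inner f f" "inner f f = 0 \<longleftrightarrow> f = 0" "norm f = sqrt (inner f f)"
    by (simp_all add: inner_L2_def norm_L2_def cinner_L2_self_ge_0 cinner_L2_self_eq_0)
qed

end

lemma square_integrable_rep: "square_integrable (rep_L2 f)"
  using Quotient_rep_reflp[OF Quotient_L2, of f] by (simp add: L2_rel_def)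

lemma norm_abs_L2:
  assumes "square_integrable f"
  shows "(norm (abs_L2 f))\<^sup>2 = (\<integral>x. (cmod (f x))\<^sup>2 \<partial>M01)"
proof -
  have "L2_rel f f"
    using assms by (simp add: L2_rel_def)
  then have "Re (cinner_L2 (abs_L2 f) (abs_L2 f)) = (\<integral>x. (cmod (f x))\<^sup>2 \<partial>M01)"
    using assms by (simp add: cinner_L2.abs_eq cinner_L2_self)
  then show ?thesis
    by (simp add: norm_L2_def)
qed

lemma norm_diff_rep:
  "(norm (f - g))\<^sup>2 = (\<integral>x. (cmod (rep_L2 f x - rep_L2 g x))\<^sup>2 \<partial>M01)"
proof -
  have "L2_rel (rep_L2 h) (rep_L2 h)" for h
    by (simp add: L2_rel_def square_integrable_rep)
  then have "abs_L2 (\<lambda>x. rep_L2 f x - rep_L2 g x) = f - g"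
    using minus_L2.abs_eq[of "rep_L2 f" "rep_L2 g"]
    by (simp add: Quotient_abs_rep[OF Quotient_L2])
  with norm_abs_L2[of "\<lambda>x. rep_L2 f x - rep_L2 g x"] show ?thesis
    by (simp add: square_integrable_diff square_integrable_rep)
qed


lemma nn_integral_cmod_le:
  assumes f: "square_integrable f" and le: "(\<integral>x. (cmod (f x))\<^sup>2 \<partial>M01) \<le> t\<^sup>2" and "0 < t"
  shows "(\<integral>\<^sup>+x. ennreal (cmod (f x)) \<partial>M01) \<le> ennreal t"
proof -
  have int: "integrable M01 (\<lambda>x. (cmod (f x))\<^sup>2)"
    using f by (simp add: square_integrable_def)
  have pw: "c \<le> c\<^sup>2 / (2 * t) + t / 2" for c :: real
  proof -
    have "2 * c * t \<le> c\<^sup>2 + t\<^sup>2"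
      by (rule sum_squares_bound)
    then have "(2 * c * t) / (2 * t) \<le> (c\<^sup>2 + t\<^sup>2) / (2 * t)"
      using \<open>0 < t\<close> by (intro divide_right_mono) auto
    also have "(2 * c * t) / (2 * t) = c"
      using \<open>0 < t\<close> by simp
    also have "(c\<^sup>2 + t\<^sup>2) / (2 * t) = c\<^sup>2 / (2 * t) + t / 2"
      using \<open>0 < t\<close> by (simp add: add_divide_distrib power2_eq_square)
    finally show ?thesis .
  qed
  have const: "integrable M01 (\<lambda>x. t / 2)" "(\<integral>x. t / 2 \<partial>M01) = t / 2"
    by (simp_all add: measure_restrict_space space_restrict_space)
  have "(\<integral>\<^sup>+x. ennreal (cmod (f x)) \<partial>M01)
      \<le> (\<integral>\<^sup>+x. ennreal ((cmod (f x))\<^sup>2 / (2 * t) + t / 2) \<partial>M01)"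
    by (intro nn_integral_mono ennreal_leI pw)
  also have "\<dots> = ennreal (\<integral>x. (cmod (f x))\<^sup>2 / (2 * t) + t / 2 \<partial>M01)"
    by (intro nn_integral_eq_integral Bochner_Integration.integrable_add
          Bochner_Integration.integrable_divide int const AE_I2)
      (use \<open>0 < t\<close> in auto)
  also have "(\<integral>x. (cmod (f x))\<^sup>2 / (2 * t) + t / 2 \<partial>M01)
      = (\<integral>x. (cmod (f x))\<^sup>2 \<partial>M01) / (2 * t) + t / 2"
    using int const by simp
  also have "\<dots> \<le> t\<^sup>2 / (2 * t) + t / 2"
    using le \<open>0 < t\<close> by (intro add_right_mono divide_right_mono) auto
  also have "\<dots> = t"
    using \<open>0 < t\<close> by (simp add: power2_eq_square)
  finally show ?thesis
    by (simp add: ennreal_leI)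
qed

instance L2 :: complete_space
proof
  fix X :: "nat \<Rightarrow> L2"
  assume "Cauchy X"
  then have "\<forall>k. \<exists>N. \<forall>m\<ge>N. \<forall>n\<ge>N. norm (X m - X n) < (1/2)^k"
    by (simp add: Cauchy_iff)
  then obtain N where N: "\<And>k m n. m \<ge> N k \<Longrightarrow> n \<ge> N k \<Longrightarrow> norm (X m - X n) < (1/2)^k"
    by metis
  define r where "r k = sum N {..k}" for k
  have r_ge: "N j \<le> r k" if "j \<le> k" for j k
    unfolding r_def using that by (intro member_le_sum) auto
  define f where "f n = rep_L2 (X (r n))" for n
  have sq: "square_integrable (f n)" for n
    by (simp add: f_def square_integrable_rep)
  then have meas[measurable]: "f n \<in> borel_measurable M01" for n
    by (simp add: square_integrable_def)
  have step: "(\<integral>\<^sup>+x. ennreal (cmod (f (Suc n) x - f n x)) \<partial>M01) \<le> ennreal ((1/2)^n)" for n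
  proof (rule nn_integral_cmod_le)
    have "norm (X (r (Suc n)) - X (r n)) < (1/2)^n"
      by (intro N r_ge) auto
    then show "(\<integral>x. (cmod (f (Suc n) x - f n x))\<^sup>2 \<partial>M01) \<le> ((1/2)^n)\<^sup>2"
      unfolding f_def norm_diff_rep[symmetric] by (intro power_mono) auto
  qed (auto intro: square_integrable_diff sq)
  have "(\<integral>\<^sup>+x. (\<Sum>n. ennreal (cmod (f (Suc n) x - f n x))) \<partial>M01)
      = (\<Sum>n. \<integral>\<^sup>+x. ennreal (cmod (f (Suc n) x - f n x)) \<partial>M01)"
    by (intro nn_integral_suminf) auto
  also have "\<dots> \<le> (\<Sum>n. ennreal ((1/2)^n))"
    by (intro suminf_le step) auto
  also have "\<dots> < \<infinity>"
    by (simp add: suminf_ennreal2 less_top[symmetric])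
  finally have "AE x in M01. (\<Sum>n. ennreal (cmod (f (Suc n) x - f n x))) \<noteq> \<infinity>"
    by (intro nn_integral_PInf_AE) auto
  then have conv: "AE x in M01. (\<lambda>n. f n x) \<longlonglongrightarrow> lim (\<lambda>n. f n x)"
  proof eventually_elim
    case (elim x)
    then have "summable (\<lambda>n. cmod (f (Suc n) x - f n x))"
      by (intro summable_suminf_not_top) (auto simp: top_ennreal.rep_eq)
    then have "summable (\<lambda>n. f (Suc n) x - f n x)"
      by (rule summable_norm_cancel)
    then have "(\<lambda>n. (\<Sum>i<n. f (Suc i) x - f i x) + f 0 x)
        \<longlonglongrightarrow> (\<Sum>i. f (Suc i) x - f i x) + f 0 x"
      by (intro tendsto_add summable_LIMSEQ tendsto_const)
    then have "convergent (\<lambda>n. f n x)"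
      by (auto simp: sum_lessThan_telescope[of "\<lambda>n. f n x"] convergent_def)
    then show ?case
      by (simp add: convergent_LIMSEQ_iff)
  qed
  define F where "F x = lim (\<lambda>n. f n x)" for x
  have [measurable]: "F \<in> borel_measurable M01"
    unfolding F_def by measurable
  have near: "(\<integral>\<^sup>+x. ennreal ((cmod (rep_L2 (X m) x - F x))\<^sup>2) \<partial>M01) \<le> ennreal (((1/2)^k)\<^sup>2)"
    if m: "m \<ge> N k" for k m
  proof -
    have [measurable]: "rep_L2 (X m) \<in> borel_measurable M01"
      using square_integrable_rep square_integrable_def by blast
    have "(\<integral>\<^sup>+x. ennreal ((cmod (rep_L2 (X m) x - F x))\<^sup>2) \<partial>M01)
        = (\<integral>\<^sup>+x. liminf (\<lambda>n. ennreal ((cmod (rep_L2 (X m) x - f n x))\<^sup>2)) \<partial>M01)"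
    proof (rule nn_integral_cong_AE, use conv in eventually_elim)
      case (elim x)
      then have "(\<lambda>n. ennreal ((cmod (rep_L2 (X m) x - f n x))\<^sup>2))
          \<longlonglongrightarrow> ennreal ((cmod (rep_L2 (X m) x - F x))\<^sup>2)"
        unfolding F_def by (intro tendsto_intros tendsto_ennrealI)
      then show ?case
        by (intro lim_imp_Liminf[symmetric]) simp
    qed
    also have "\<dots> \<le> liminf (\<lambda>n. \<integral>\<^sup>+x. ennreal ((cmod (rep_L2 (X m) x - f n x))\<^sup>2) \<partial>M01)"
      by (intro nn_integral_liminf) auto
    also have "\<dots> \<le> ennreal (((1/2)^k)\<^sup>2)"
    proof (rule Liminf_le)
      have "(\<integral>\<^sup>+x. ennreal ((cmod (rep_L2 (X m) x - f n x))\<^sup>2) \<partial>M01) \<le> ennreal (((1/2)^k)\<^sup>2)"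
        if "n \<ge> k" for n
      proof -
        have "square_integrable (\<lambda>x. rep_L2 (X m) x - f n x)"
          by (intro square_integrable_diff square_integrable_rep sq)
        then have "(\<integral>\<^sup>+x. ennreal ((cmod (rep_L2 (X m) x - f n x))\<^sup>2) \<partial>M01)
            = ennreal ((norm (X m - X (r n)))\<^sup>2)"
          unfolding norm_diff_rep f_def
          by (intro nn_integral_eq_integral) (auto simp: square_integrable_def)
        also have "\<dots> \<le> ennreal (((1/2)^k)\<^sup>2)"
          using N[OF m r_ge[OF that]] by (intro ennreal_leI power_mono) auto
        finally show ?thesis .
      qed
      then show "\<forall>\<^sub>F n in sequentially.
          (\<integral>\<^sup>+x. ennreal ((cmod (rep_L2 (X m) x - f n x))\<^sup>2) \<partial>M01) \<le> ennreal (((1/2)^k)\<^sup>2)"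
        by (auto simp: eventually_sequentially)
    qed simp
    finally show ?thesis .
  qed
  have diff: "square_integrable (\<lambda>x. rep_L2 (X m) x - F x)" if "m \<ge> N k" for k m
  proof -
    have [measurable]: "rep_L2 (X m) \<in> borel_measurable M01"
      using square_integrable_rep square_integrable_def by blast
    have "integrable M01 (\<lambda>x. (cmod (rep_L2 (X m) x - F x))\<^sup>2)"
      using near[OF that] by (intro integrableI_bounded) (auto simp: le_less_trans)
    then show ?thesis
      by (simp add: square_integrable_def)
  qed
  have F: "square_integrable F"
    using square_integrable_diff[OF square_integrable_rep[of "X (N 0)"] diff[of 0 "N 0"]] by simp
  have "X \<longlonglongrightarrow> abs_L2 F"
  proof (rule metric_LIMSEQ_I)
    fix e :: real
    assume "0 < e"
    then obtain k where k: "(1/2)^k < e"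
      using real_arch_pow_inv[of e "1/2"] by auto
    have "dist (X m) (abs_L2 F) < e" if m: "m \<ge> N k" for m
    proof -
      have "L2_rel (rep_L2 (X m)) (rep_L2 (X m))" "L2_rel F F"
        by (simp_all add: L2_rel_def F square_integrable_rep)
      then have "abs_L2 (\<lambda>x. rep_L2 (X m) x - F x) = X m - abs_L2 F"
        using minus_L2.abs_eq[of "rep_L2 (X m)" F]
        by (simp add: Quotient_abs_rep[OF Quotient_L2])
      then have "(norm (X m - abs_L2 F))\<^sup>2 = (\<integral>x. (cmod (rep_L2 (X m) x - F x))\<^sup>2 \<partial>M01)"
        using norm_abs_L2[OF diff[OF m]] by simp
      moreover have "ennreal (\<integral>x. (cmod (rep_L2 (X m) x - F x))\<^sup>2 \<partial>M01)
          = (\<integral>\<^sup>+x. ennreal ((cmod (rep_L2 (X m) x - F x))\<^sup>2) \<partial>M01)"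
        using diff[OF m]
        by (intro nn_integral_eq_integral[symmetric]) (auto simp: square_integrable_def)
      ultimately have "(norm (X m - abs_L2 F))\<^sup>2 \<le> ((1/2)^k)\<^sup>2"
        using near[OF m] by (metis ennreal_le_iff zero_le_power2)
      then have "norm (X m - abs_L2 F) \<le> (1/2)^k"
        by (rule power2_le_imp_le) simp
      with k show ?thesis
        by (simp add: dist_norm)
    qed
    then show "\<exists>no. \<forall>n\<ge>no. dist (X n) (abs_L2 F) < e"
      by blast
  qed
  then show "convergent X"
    by (rule convergentI)
qed

instance L2 :: banach ..


section \<open>Reflection-even and reflection-odd functions\<close>

lemma AE_M01_reflect:
  assumes "AE x in M01. Q x"
  shows "AE x in M01. Q (1 - x)"
proof -
  have iff: "(AE x in M01. R x) \<longleftrightarrow> negligible {x \<in> {0..1}. \<not> R x}" for R :: "real \<Rightarrow> bool"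
  proof -
    have "(AE x in M01. R x) \<longleftrightarrow> (AE x in lebesgue. x \<in> {0..1} \<longrightarrow> R x)"
      by (rule AE_restrict_space_iff) simp
    also have "\<dots> \<longleftrightarrow> {x. \<not> (x \<in> {0..1} \<longrightarrow> R x)} \<in> null_sets lebesgue"
      by (subst completion.AE_iff_null_sets) (simp_all add: Compl_eq)
    finally show ?thesis
      by (simp add: negligible_iff_null_sets Collect_conj_eq)
  qed
  have "negligible ((\<lambda>x. 1 - x) ` {x \<in> {0..1}. \<not> Q x})"
    using assms unfolding iff
    by (intro negligible_differentiable_image_negligible) (auto intro!: derivative_intros)
  moreover have "{x \<in> {0..1}. \<not> Q (1 - x)} \<subseteq> (\<lambda>x. 1 - x) ` {x \<in> {0..1}. \<not> Q x}"
  proof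
    fix x :: real
    assume "x \<in> {x \<in> {0..1}. \<not> Q (1 - x)}"
    then show "x \<in> (\<lambda>x. 1 - x) ` {x \<in> {0..1}. \<not> Q x}"
      by (intro image_eqI[of _ _ "1 - x"]) auto
  qed
  ultimately show ?thesis
    unfolding iff by (rule negligible_subset)
qed

lift_definition reflection_even :: "L2 \<Rightarrow> bool" is "\<lambda>f. AE x in M01. f x = f (1 - x)"
proof -
  fix f g assume "L2_rel f g"
  then have *: "AE x in M01. f x = g x"
    by (simp add: L2_rel_def)
  from * AE_M01_reflect[OF *] have "AE x in M01. f x = g x \<and> f (1 - x) = g (1 - x)"
    by (rule eventually_conj)
  then show "(AE x in M01. f x = f (1 - x)) \<longleftrightarrow> (AE x in M01. g x = g (1 - x))"
    by (rule eventually_cong) auto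
qed

lift_definition reflection_odd :: "L2 \<Rightarrow> bool" is "\<lambda>f. AE x in M01. f x = - f (1 - x)"
proof -
  fix f g assume "L2_rel f g"
  then have *: "AE x in M01. f x = g x"
    by (simp add: L2_rel_def)
  from * AE_M01_reflect[OF *] have "AE x in M01. f x = g x \<and> f (1 - x) = g (1 - x)"
    by (rule eventually_conj)
  then show "(AE x in M01. f x = - f (1 - x)) \<longleftrightarrow> (AE x in M01. g x = - g (1 - x))"
    by (rule eventually_cong) auto
qed

definition P_space :: "L2 set"
  where "P_space = {f. reflection_even f}"

definition A_space :: "L2 set"
  where "A_space = {f. reflection_odd f}"

text \<open>
  \<open>H\<close> is the internal Hilbert space direct sum of \<open>U\<close> and \<open>V\<close>: besides the algebraic conditions
  for complex subspaces, both summands are closed and they are orthogonal to each other.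
\<close>

definition L2_direct_sum :: "L2 set \<Rightarrow> L2 set \<Rightarrow> L2 set \<Rightarrow> bool"
  where "L2_direct_sum H U V \<longleftrightarrow>
    L2.subspace U \<and> closed U \<and> L2.subspace V \<and> closed V \<and>
    (\<forall>f\<in>U. \<forall>g\<in>V. cinner_L2 f g = 0) \<and>
    U \<inter> V = {0} \<and> {f + g | f g. f \<in> U \<and> g \<in> V} = H"

end

theory Submission
  imports Defs
begin

text \<open>
  The decomposition is the spectral decomposition of the reflection \<open>(R f)(x) = f (1 - x)\<close>.
  The map \<open>x \<mapsto> 1 - x\<close> is an involution of \<open>[0,1]\<close> that preserves Lebesgue measure
  (\<open>distr_reflect_M01\<close>), so \<open>R\<close> is a well-defined unitary involution of \<open>L\<^sup>2[0,1]\<close>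
  (\<open>reflect_L2_reflect_L2\<close>, \<open>cinner_reflect_L2\<close>). The even functions are its eigenspace for
  the eigenvalue \<open>1\<close>, the odd functions its eigenspace for \<open>-1\<close>. Hence both are closed
  subspaces, because \<open>R\<close> is linear and continuous; they are orthogonal, because
  \<open>\<langle>f, g\<rangle> = \<langle>R f, R g\<rangle> = - \<langle>f, g\<rangle>\<close> for \<open>f\<close> even and \<open>g\<close> odd; and they span
  everything, because \<open>f = (f + R f) / 2 + (f - R f) / 2\<close>.
\<close>

lemma reflect_vimage_eq_image:
  fixes A :: "real set"
  assumes "A \<subseteq> {0..1}"
  shows "(\<lambda>x. 1 - x) -` A \<inter> {0..1} = (\<lambda>x. (-1) *\<^sub>R x + 1) ` A"
proof (intro set_eqI iffI)
  fix x
  assume "x \<in> (\<lambda>x. 1 - x) -` A \<inter> {0..1}"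
  then show "x \<in> (\<lambda>x. (-1) *\<^sub>R x + 1) ` A"
    by (intro image_eqI[of _ _ "1 - x"]) auto
next
  fix x
  assume "x \<in> (\<lambda>x. (-1) *\<^sub>R x + 1) ` A"
  with assms show "x \<in> (\<lambda>x. 1 - x) -` A \<inter> {0..1}"
    by auto
qed

lemma measurable_reflect_M01 [measurable]: "(\<lambda>x. 1 - x) \<in> M01 \<rightarrow>\<^sub>M M01"
proof (rule measurable_restrict_space3)
  show "(\<lambda>x::real. 1 - x) \<in> lebesgue \<rightarrow>\<^sub>M lebesgue"
    using lebesgue_affine_measurable[of "\<lambda>_. -1" "1 :: real"] by simp
qed auto

text \<open>
  The preimage of a measurable set under the reflection is its image under an affine map of
  slope \<open>-1\<close>, which multiplies Lebesgue measure by \<open>\<bar>-1\<bar> = 1\<close>.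
\<close>

lemma distr_reflect_M01: "distr M01 M01 (\<lambda>x. 1 - x) = M01"
proof (rule measure_eqI)
  fix A
  assume "A \<in> sets (distr M01 M01 (\<lambda>x. 1 - x))"
  then have A: "A \<in> sets M01"
    by simp
  then have sub: "A \<subseteq> {0..1}"
    using sets.sets_into_space[OF A] by simp
  have "emeasure (distr M01 M01 (\<lambda>x. 1 - x)) A
      = emeasure M01 ((\<lambda>x. 1 - x) -` A \<inter> {0..1})"
    using A by (simp add: emeasure_distr)
  also have "\<dots> = emeasure lebesgue ((\<lambda>x. 1 - x) -` A \<inter> {0..1})"
    by (rule emeasure_restrict_space) auto
  also have "\<dots> = emeasure lebesgue A"
    unfolding reflect_vimage_eq_image[OF sub] by (subst emeasure_lebesgue_affine) simp
  also have "\<dots> = emeasure M01 A"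
    using sub by (simp add: emeasure_restrict_space)
  finally show "emeasure (distr M01 M01 (\<lambda>x. 1 - x)) A = emeasure M01 A" .
qed simp

lemma integral_reflect_M01:
  fixes h :: "real \<Rightarrow> complex"
  assumes "h \<in> borel_measurable M01"
  shows "(\<integral>x. h (1 - x) \<partial>M01) = (\<integral>x. h x \<partial>M01)"
  using integral_distr[OF measurable_reflect_M01 assms] by (simp add: distr_reflect_M01)

lemma square_integrable_reflect:
  assumes "square_integrable f"
  shows "square_integrable (\<lambda>x. f (1 - x))"
proof -
  have f [measurable]: "f \<in> borel_measurable M01"
    and int: "integrable M01 (\<lambda>x. (cmod (f x))\<^sup>2)"
    using assms by (auto simp: square_integrable_def)
  have "integrable (distr M01 M01 (\<lambda>x. 1 - x)) (\<lambda>x. (cmod (f x))\<^sup>2)"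
    using int by (simp add: distr_reflect_M01)
  then have "integrable M01 (\<lambda>x. (cmod (f (1 - x)))\<^sup>2)"
    by (rule integrable_distr[OF measurable_reflect_M01])
  moreover have "(\<lambda>x. f (1 - x)) \<in> borel_measurable M01"
    by (rule measurable_compose[OF measurable_reflect_M01 f])
  ultimately show ?thesis
    by (simp add: square_integrable_def)
qed

lift_definition reflect_L2 :: "L2 \<Rightarrow> L2" is "\<lambda>f x. f (1 - x)"
proof -
  fix f g
  assume "L2_rel f g"
  then have fg: "square_integrable f" "square_integrable g" "AE x in M01. f x = g x"
    by (simp_all add: L2_rel_def)
  show "L2_rel (\<lambda>x. f (1 - x)) (\<lambda>x. g (1 - x))"
    using square_integrable_reflect[OF fg(1)] square_integrable_reflect[OF fg(2)]
      AE_M01_reflect[OF fg(3)]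
    by (simp add: L2_rel_def)
qed

lemma reflect_L2_add: "reflect_L2 (f + g) = reflect_L2 f + reflect_L2 g"
  by transfer (auto simp: L2_rel_def intro!: square_integrable_add square_integrable_reflect)

lemma reflect_L2_scaleC: "reflect_L2 (c *\<^sub>C f) = c *\<^sub>C reflect_L2 f"
  by transfer (auto simp: L2_rel_def intro!: square_integrable_scale square_integrable_reflect)

lemma reflect_L2_diff: "reflect_L2 (f - g) = reflect_L2 f - reflect_L2 g"
  by transfer (auto simp: L2_rel_def intro!: square_integrable_diff square_integrable_reflect)

lemma reflect_L2_zero: "reflect_L2 0 = 0"
  by transfer (simp add: L2_rel_def square_integrable_zero)

lemma reflect_L2_reflect_L2: "reflect_L2 (reflect_L2 f) = f"
  by transfer (auto simp: L2_rel_def)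

lemma cinner_reflect_L2: "cinner_L2 (reflect_L2 f) (reflect_L2 g) = cinner_L2 f g"
proof (transfer, goal_cases)
  case (1 f g)
  then show ?case
    by (intro integral_reflect_M01[of "\<lambda>x. f x * cnj (g x)"] measurable_inner_product)
      (simp_all add: L2_rel_def)
qed

lemma cinner_L2_minus_right: "cinner_L2 f (- g) = - cinner_L2 f g"
  by transfer simp

lemma continuous_on_reflect_L2: "continuous_on S reflect_L2"
proof -
  have "bounded_linear reflect_L2"
  proof (rule bounded_linear_intro)
    show "norm (reflect_L2 f) \<le> norm f * 1" for f
      by (simp add: norm_L2_def cinner_reflect_L2)
  qed (simp_all add: reflect_L2_add reflect_L2_scaleC scaleR_L2_def)
  then show ?thesis
    by (rule linear_continuous_on)
qed

lemma P_space_eq_fixed_points: "P_space = {f. reflect_L2 f = f}"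
proof -
  have "reflection_even f \<longleftrightarrow> reflect_L2 f = f" for f
  proof (transfer, goal_cases)
    case (1 f)
    then have "square_integrable f"
      by (simp add: L2_rel_def)
    then show ?case
      by (simp add: L2_rel_def square_integrable_reflect eq_commute)
  qed
  then show ?thesis
    by (simp add: P_space_def)
qed

lemma A_space_eq_negated_points: "A_space = {f. reflect_L2 f = - f}"
proof -
  have "reflection_odd f \<longleftrightarrow> reflect_L2 f = - f" for f
  proof (transfer, goal_cases)
    case (1 f)
    then have "square_integrable f"
      by (simp add: L2_rel_def)
    moreover have "f x = - f (1 - x) \<longleftrightarrow> f (1 - x) = - f x" for x
      by (metis minus_minus)
    ultimately show ?case
      by (simp add: L2_rel_def square_integrable_reflect square_integrable_minus)
  qed
  then show ?thesis
    by (simp add: A_space_def)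
qed

lemma subspace_P_space: "L2.subspace P_space"
  by (simp add: L2.subspace_def P_space_eq_fixed_points reflect_L2_zero reflect_L2_add
      reflect_L2_scaleC)

lemma subspace_A_space: "L2.subspace A_space"
  by (simp add: L2.subspace_def A_space_eq_negated_points reflect_L2_zero reflect_L2_add
      reflect_L2_scaleC)

lemma closed_P_space: "closed P_space"
  unfolding P_space_eq_fixed_points
  by (intro closed_Collect_eq continuous_on_reflect_L2 continuous_intros)

lemma closed_A_space: "closed A_space"
  unfolding A_space_eq_negated_points
  by (intro closed_Collect_eq continuous_on_reflect_L2 continuous_intros)

lemma P_space_orthogonal_A_space:
  assumes "f \<in> P_space" "g \<in> A_space"
  shows "cinner_L2 f g = 0"
proof -
  have "cinner_L2 f g = cinner_L2 (reflect_L2 f) (reflect_L2 g)"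
    by (simp add: cinner_reflect_L2)
  also have "\<dots> = - cinner_L2 f g"
    using assms
    by (simp add: P_space_eq_fixed_points A_space_eq_negated_points cinner_L2_minus_right)
  finally show ?thesis
    by simp
qed

text \<open>A common element of two orthogonal subspaces is orthogonal to itself.\<close>

lemma P_space_Int_A_space: "P_space \<inter> A_space = {0}"
proof
  show "P_space \<inter> A_space \<subseteq> {0}"
    using P_space_orthogonal_A_space by (auto simp flip: cinner_L2_self_eq_0)
  show "{0} \<subseteq> P_space \<inter> A_space"
    using L2.subspace_0[OF subspace_P_space] L2.subspace_0[OF subspace_A_space] by simp
qed

lemma P_space_plus_A_space: "\<exists>g\<in>P_space. \<exists>h\<in>A_space. f = g + h"
proof (intro bexI)
  show "f = (1/2) *\<^sub>C (f + reflect_L2 f) + (1/2) *\<^sub>C (f - reflect_L2 f)"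
    by (simp add: L2.scale_right_distrib L2.scale_right_diff_distrib
        flip: L2.scale_left_distrib)
  show "(1/2) *\<^sub>C (f + reflect_L2 f) \<in> P_space"
    by (simp add: P_space_eq_fixed_points reflect_L2_scaleC reflect_L2_add
        reflect_L2_reflect_L2 add.commute)
  show "(1/2) *\<^sub>C (f - reflect_L2 f) \<in> A_space"
    by (simp add: A_space_eq_negated_points reflect_L2_scaleC reflect_L2_diff
        reflect_L2_reflect_L2 flip: L2.scale_minus_right)
qed

theorem theorem2p20:
  shows "L2_direct_sum UNIV P_space A_space"
proof -
  have "{f + g | f g. f \<in> P_space \<and> g \<in> A_space} = UNIV"
    using P_space_plus_A_space by blast
  then show ?thesis
    unfolding L2_direct_sum_def
    by (intro conjI ballI subspace_P_space closed_P_space subspace_A_space closed_A_space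
        P_space_orthogonal_A_space P_space_Int_A_space)
qed

end
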